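(* For $j\in[p]=\{1,\dots,p\}$ let $h^j=f^j+g^j$ with $f^j:\mathbb{R}^n\to\mathbb{R}^m$ continuously differentiable and $g^j:\mathbb{R}^n\to\mathbb{R}^m\cup\{+\infty_C\}$ proper, closed and $C$-convex, and let $H(x)=\{h^1(x),\dots,h^p(x)\}$. Let $x^0\in\mathrm{dom}(H)$ and assume that $H$ satisfies the following: with $\mathcal{L}:=\{x\in\mathbb{R}^n: H(x)\preceq^\ell H(x^0)\}$, for every sequence of sets $\{S_k\}_{k\ge0}$ with each $S_k\in\{H(x):x\in\mathcal{L}\}$ and $S_{k+1}\preceq^\ell S_k$ for all $k$, there exists a bounded set $S\subseteq\mathbb{R}^m$ with $S\preceq^\ell S_k$ for all $k\in\mathbb{N}\cup\{0\}$. Let $\{x^k\}$ be an infinite sequence of non-stationary points in $\mathrm{dom}(H)$ of the problem $\preceq^\ell$-$\min_{x\in\mathbb{R}^n} H(x)$, generated from $x^0$ by the proximal gradient method with line search with parameters $\rho,\mu\in(0,1)$ and $l>0$ (defined in the context), with associated directions $v^k_l$. Then, for any $\varepsilon>0$, there exists $k\in\mathbb{N}\cup\{0\}$ such that $\|v^k_l\|\le\varepsilon$.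
   Context: $C\subset\mathbb{R}^m$ is a closed, convex, pointed cone with nonempty interior; $w\preceq_C w'$ iff $w'-w\in C$, $w\prec_C w'$ iff $w'-w\in\mathrm{int}(C)$. The extra element $+\infty_C$ satisfies $w\prec_C+\infty_C$ for all $w\in\mathbb{R}^m$. For sets, $U\preceq^\ell V$ iff $V\subseteq U+C$, i.e. for every $v\in V$ there is $u\in U$ with $u\preceq_C v$. $\mathrm{dom}(H):=\{x:h^j(x)\prec_C+\infty_C\ \forall j\in[p]\}$. $C^*=\{z:w^\top z\ge0\ \forall w\in C\}$, $\mathcal{Z}:=\{z\in C^*:\|z\|=1\}$, $\phi(w):=\sup_{z\in\mathcal{Z}}z^\top w$, with $z^\top(+\infty_C):=+\infty$ for $z\in C^*\setminus\{0\}$ and $\phi(+\infty_C):=+\infty$. $\nabla f^j(x)\in\mathbb{R}^{n\times m}$ is the transposed Jacobian. A function $g:\mathbb{R}^n\to\mathbb{R}^m\cup\{+\infty_C\}$ is $C$-convex if $g(\lambda x+(1-\lambda)y)\preceq_C\lambda g(x)+(1-\lambda)g(y)$ for all $x,y$ and $\lambda\in(0,1]$; proper if not identically $+\infty_C$; closed if $x\mapsto z^\top g(x)$ is lower semicontinuous for every $z\in C^*\setminus\{0\}$. Minimal set: $\mathcal{M}(U,C):=\{u\in U:\nexists\,u'\in U,\ u'\ne u,\ u'\preceq_C u\}$; $\omega(x):=|\mathcal{M}(H(x),C)|$, $[\omega(x)]=\{1,\dots,\omega(x)\}$. Partition set: enumerate $\mathcal{M}(H(x),C)=\{u_1^x,\dots,u_{\omega(x)}^x\}$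 and, with $I_u(x):=\{j\in[p]:h^j(x)=u\}$, put $P_x:=\prod_{j=1}^{\omega(x)}I_{u_j^x}(x)$; elements are written $a=(a_1,\dots,a_{\omega(x)})$. Directional derivative: $D_vh(y):=\lim_{\alpha\to0^+}\frac1\alpha(h(y+\alpha v)-h(y))$ in the extended sense: $D_vh(y)\in-\mathrm{int}(C)$ means $\lim_{\alpha\to0^+}\frac1\alpha z^\top(h(y+\alpha v)-h(y))<0$ in $[-\infty,+\infty]$ for all $z\in C^*\setminus\{0\}$. A point $y\in\mathrm{dom}(H)$ is stationary if for every $a\in P_y$ and every $v\in\mathbb{R}^n$ there is $j\in[\omega(y)]$ with $D_vh^{a_j}(y)\notin-\mathrm{int}(C)$; otherwise non-stationary. Proximal gradient method with line search (stopping test disregarded): at iterate $x^k$, with $\omega_k:=\omega(x^k)$, $P_k:=P_{x^k}$, choose $$(a^l_k,v^k_l)\in\operatorname*{arg\,min}_{(a,v)\in P_k\times\mathbb{R}^n}\left\{\max_{j\in[\omega_k]}\phi\left(\nabla f^{a_j}(x^k)^\top v+g^{a_j}(x^k+v)-g^{a_j}(x^k)\right)+\frac l2\|v\|^2\right\}$$ (the minimum is attained); let $\alpha_k=\mu^i$ with $i\in\mathbb{N}\cup\{0\}$ the smallest exponent such that, writing $a^l_k=(a^l_{k,1},\dots,a^l_{k,\omega_k})$, $$h^{a^l_{k,j}}(x^k+\mu^iv^k_l)\preceq_C h^{a^l_{k,j}}(x^k)+\rho\mu^i\left(\nabla f^{a^l_{k,j}}(x^k)^\top v^k_l+g^{a^l_{k,j}}(x^k+v^k_l)-g^{a^l_{k,j}}(x^k)\right)\quad\forall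 j\in[\omega_k];$$ set $x^{k+1}:=x^k+\alpha_kv^k_l$. *)

theory Defs
  imports "HOL-Analysis.Analysis"
begin

text \<open>
  \<open>Top\<close> is the element \<open>+\<infinity>\<^sub>C\<close> adjoined to the vector space.
\<close>

datatype 'a cext = Vec 'a | Top

text \<open>
  In the notions below every scalar is nonnegative and the subtrahend of every difference is
  finite, so the values of \<open>t *\<^sub>R Top\<close> for \<open>t < 0\<close> and of \<open>w - Top\<close> are irrelevant.  The value
  \<open>0 *\<^sub>R Top = Top\<close> only matters for \<open>t = 1\<close> in \<open>C_convex\<close>, where the inequality holds trivially
  under either convention \<open>0 *\<^sub>R Top = Top\<close> or \<open>0 *\<^sub>R Top = 0\<close>.
\<close>

instantiation cext :: (plus) plus
begin
fun plus_cext :: "'a cext \<Rightarrow> 'a cext \<Rightarrow> 'a cext" where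
  "Vec a + Vec b = Vec (a + b)"
| "Top + w = Top"
| "w + Top = Top"
instance ..
end

instantiation cext :: (minus) minus
begin
fun minus_cext :: "'a cext \<Rightarrow> 'a cext \<Rightarrow> 'a cext" where
  "Vec a - Vec b = Vec (a - b)"
| "Top - w = Top"
| "w - Top = Top"
instance ..
end

instantiation cext :: (scaleR) scaleR
begin
fun scaleR_cext :: "real \<Rightarrow> 'a cext \<Rightarrow> 'a cext" where
  "t *\<^sub>R Vec a = Vec (t *\<^sub>R a)"
| "t *\<^sub>R Top = Top"
instance ..
end

fun cone_le :: "'a::real_normed_vector set \<Rightarrow> 'a cext \<Rightarrow> 'a cext \<Rightarrow> bool" where
  "cone_le C (Vec a) (Vec b) \<longleftrightarrow> b - a \<in> C"
| "cone_le C w Top \<longleftrightarrow> True"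
| "cone_le C Top (Vec b) \<longleftrightarrow> False"

fun cone_less :: "'a::real_normed_vector set \<Rightarrow> 'a cext \<Rightarrow> 'a cext \<Rightarrow> bool" where
  "cone_less C (Vec a) (Vec b) \<longleftrightarrow> b - a \<in> interior C"
| "cone_less C (Vec a) Top \<longleftrightarrow> True"
| "cone_less C Top w \<longleftrightarrow> False"

definition set_le :: "'a::real_normed_vector set \<Rightarrow> 'a cext set \<Rightarrow> 'a cext set \<Rightarrow> bool" where
  "set_le C U V \<longleftrightarrow> (\<forall>v\<in>V. \<exists>u\<in>U. cone_le C u v)"

definition pointed :: "'a::real_vector set \<Rightarrow> bool" where
  "pointed C \<longleftrightarrow> C \<inter> uminus ` C = {0}"

definition dual_cone :: "'a::real_inner set \<Rightarrow> 'a set" where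
  "dual_cone C = {z. \<forall>w\<in>C. 0 \<le> w \<bullet> z}"

definition dual_sphere :: "'a::real_inner set \<Rightarrow> 'a set" where
  "dual_sphere C = {z \<in> dual_cone C. norm z = 1}"

text \<open>\<open>ext_inner z w\<close> is only used for nonzero \<open>z\<close> in the dual cone.\<close>

fun ext_inner :: "'a::real_inner \<Rightarrow> 'a cext \<Rightarrow> ereal" where
  "ext_inner z (Vec a) = ereal (z \<bullet> a)"
| "ext_inner z Top = \<infinity>"

fun phi :: "'a::real_inner set \<Rightarrow> 'a cext \<Rightarrow> ereal" where
  "phi C (Vec a) = (SUP z\<in>dual_sphere C. ext_inner z (Vec a))"
| "phi C Top = \<infinity>"

text \<open>The transposed Jacobian, an \<open>n \<times> m\<close> matrix (type \<open>real^'m^'n\<close> has rows indexed by \<open>'n\<close>).\<close>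

definition nabla :: "(real^'n \<Rightarrow> real^'m) \<Rightarrow> real^'n \<Rightarrow> real^'m^'n" where
  "nabla f x = transpose (jacobian f (at x))"

definition C1 :: "(real^'n \<Rightarrow> real^'m) \<Rightarrow> bool" where
  "C1 f \<longleftrightarrow> (\<forall>x. f differentiable (at x)) \<and> continuous_on UNIV (nabla f)"

definition C_convex :: "'b::real_normed_vector set \<Rightarrow> ('a::real_vector \<Rightarrow> 'b cext) \<Rightarrow> bool" where
  "C_convex C g \<longleftrightarrow> (\<forall>x y. \<forall>t\<in>{0<..1}.
     cone_le C (g (t *\<^sub>R x + (1 - t) *\<^sub>R y)) (t *\<^sub>R g x + (1 - t) *\<^sub>R g y))"

definition proper :: "('a \<Rightarrow> 'b cext) \<Rightarrow> bool" where
  "proper g \<longleftrightarrow> \<not> (\<forall>x. g x = Top)"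

definition lower_semicontinuous :: "('a::topological_space \<Rightarrow> ereal) \<Rightarrow> bool" where
  "lower_semicontinuous F \<longleftrightarrow> (\<forall>x. F x \<le> Liminf (at x) F)"

definition C_closed :: "'b::real_inner set \<Rightarrow> ('a::topological_space \<Rightarrow> 'b cext) \<Rightarrow> bool" where
  "C_closed C g \<longleftrightarrow>
     (\<forall>z \<in> dual_cone C - {0}. lower_semicontinuous (\<lambda>x. ext_inner z (g x)))"

definition hfun :: "(nat \<Rightarrow> 'a \<Rightarrow> 'b::plus) \<Rightarrow> (nat \<Rightarrow> 'a \<Rightarrow> 'b cext) \<Rightarrow> nat \<Rightarrow> 'a \<Rightarrow> 'b cext" where
  "hfun f g j x = Vec (f j x) + g j x"

definition Hmap :: "nat \<Rightarrow> (nat \<Rightarrow> 'a \<Rightarrow> 'b cext) \<Rightarrow> 'a \<Rightarrow> 'b cext set" where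
  "Hmap p h x = (\<lambda>j. h j x) ` {1..p}"

definition domH :: "'b::real_normed_vector set \<Rightarrow> nat \<Rightarrow> (nat \<Rightarrow> 'a \<Rightarrow> 'b cext) \<Rightarrow> 'a set" where
  "domH C p h = {x. \<forall>j\<in>{1..p}. cone_less C (h j x) Top}"

definition level_set ::
  "'b::real_normed_vector set \<Rightarrow> nat \<Rightarrow> (nat \<Rightarrow> 'a \<Rightarrow> 'b cext) \<Rightarrow> 'a \<Rightarrow> 'a set" where
  "level_set C p h x0 = {x. set_le C (Hmap p h x) (Hmap p h x0)}"

definition chains_bounded_below ::
  "'b::real_normed_vector set \<Rightarrow> nat \<Rightarrow> (nat \<Rightarrow> 'a \<Rightarrow> 'b cext) \<Rightarrow> 'a \<Rightarrow> bool" where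
  "chains_bounded_below C p h x0 \<longleftrightarrow>
     (\<forall>S :: nat \<Rightarrow> 'b cext set.
        (\<forall>k. S k \<in> Hmap p h ` level_set C p h x0) \<and> (\<forall>k. set_le C (S (Suc k)) (S k))
        \<longrightarrow> (\<exists>B :: 'b set. bounded B \<and> (\<forall>k. set_le C (Vec ` B) (S k))))"

definition minimal_set :: "'b::real_normed_vector set \<Rightarrow> 'b cext set \<Rightarrow> 'b cext set" where
  "minimal_set C U = {u \<in> U. \<not> (\<exists>u'\<in>U. u' \<noteq> u \<and> cone_le C u' u)}"

definition omega ::
  "'b::real_normed_vector set \<Rightarrow> nat \<Rightarrow> (nat \<Rightarrow> 'a \<Rightarrow> 'b cext) \<Rightarrow> 'a \<Rightarrow> nat" where
  "omega C p h x = card (minimal_set C (Hmap p h x))"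

definition active :: "nat \<Rightarrow> (nat \<Rightarrow> 'a \<Rightarrow> 'b cext) \<Rightarrow> 'b cext \<Rightarrow> 'a \<Rightarrow> nat set" where
  "active p h u x = {j \<in> {1..p}. h j x = u}"

text \<open>
  An enumeration \<open>u x 1, \<dots>, u x (omega C p h x)\<close> of the minimal elements of \<open>H x\<close> is fixed for
  every \<open>x\<close>; the partition sets are taken with respect to it.
\<close>

definition enumerates_minimal ::
  "'b::real_normed_vector set \<Rightarrow> nat \<Rightarrow> (nat \<Rightarrow> 'a \<Rightarrow> 'b cext) \<Rightarrow> ('a \<Rightarrow> nat \<Rightarrow> 'b cext) \<Rightarrow> bool" where
  "enumerates_minimal C p h u \<longleftrightarrow>
     (\<forall>x. bij_betw (u x) {1..omega C p h x} (minimal_set C (Hmap p h x)))"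

definition partition_set ::
  "'b::real_normed_vector set \<Rightarrow> nat \<Rightarrow> (nat \<Rightarrow> 'a \<Rightarrow> 'b cext) \<Rightarrow> ('a \<Rightarrow> nat \<Rightarrow> 'b cext) \<Rightarrow>
     'a \<Rightarrow> (nat \<Rightarrow> nat) set" where
  "partition_set C p h u x = (\<Pi>\<^sub>E j\<in>{1..omega C p h x}. active p h (u x j) x)"

text \<open>\<open>dirderiv_neg C h y v\<close> is the extended-sense membership of \<open>D\<^sub>v h y\<close> in \<open>-int C\<close>.\<close>

definition dirderiv_neg ::
  "'b::real_inner set \<Rightarrow> ('a::real_vector \<Rightarrow> 'b cext) \<Rightarrow> 'a \<Rightarrow> 'a \<Rightarrow> bool" where
  "dirderiv_neg C h y v \<longleftrightarrow>
     (\<forall>z \<in> dual_cone C - {0}. \<exists>L::ereal.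
        ((\<lambda>\<alpha>. ereal (1 / \<alpha>) * ext_inner z (h (y + \<alpha> *\<^sub>R v) - h y)) \<longlongrightarrow> L) (at_right 0) \<and> L < 0)"

definition stationary ::
  "'b::real_inner set \<Rightarrow> nat \<Rightarrow> (nat \<Rightarrow> 'a::real_vector \<Rightarrow> 'b cext) \<Rightarrow> ('a \<Rightarrow> nat \<Rightarrow> 'b cext) \<Rightarrow>
     'a \<Rightarrow> bool" where
  "stationary C p h u y \<longleftrightarrow> y \<in> domH C p h \<and>
     (\<forall>a \<in> partition_set C p h u y. \<forall>v. \<exists>j\<in>{1..omega C p h y}. \<not> dirderiv_neg C (h (a j)) y v)"

definition model ::
  "(real^'n \<Rightarrow> real^'m) \<Rightarrow> (real^'n \<Rightarrow> (real^'m) cext) \<Rightarrow> real^'n \<Rightarrow> real^'n \<Rightarrow> (real^'m) cext" where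
  "model f g x v = Vec (transpose (nabla f x) *v v) + g (x + v) - g x"

definition prox_objective ::
  "(real^'m) set \<Rightarrow> nat \<Rightarrow> (nat \<Rightarrow> real^'n \<Rightarrow> real^'m) \<Rightarrow> (nat \<Rightarrow> real^'n \<Rightarrow> (real^'m) cext) \<Rightarrow>
     real \<Rightarrow> real^'n \<Rightarrow> (nat \<Rightarrow> nat) \<times> (real^'n) \<Rightarrow> ereal" where
  "prox_objective C p f g l x = (\<lambda>(a, v).
     Max ((\<lambda>j. phi C (model (f (a j)) (g (a j)) x v)) ` {1..omega C p (hfun f g) x})
     + ereal (l / 2 * (norm v)\<^sup>2))"

definition sufficient_decrease ::
  "(real^'m) set \<Rightarrow> nat \<Rightarrow> (nat \<Rightarrow> real^'n \<Rightarrow> real^'m) \<Rightarrow> (nat \<Rightarrow> real^'n \<Rightarrow> (real^'m) cext) \<Rightarrow>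
     real \<Rightarrow> real^'n \<Rightarrow> (nat \<Rightarrow> nat) \<Rightarrow> real^'n \<Rightarrow> real \<Rightarrow> bool" where
  "sufficient_decrease C p f g \<rho> x a v t \<longleftrightarrow>
     (\<forall>j\<in>{1..omega C p (hfun f g) x}.
        cone_le C (hfun f g (a j) (x + t *\<^sub>R v))
          (hfun f g (a j) x + (\<rho> * t) *\<^sub>R model (f (a j)) (g (a j)) x v))"

definition line_search_step ::
  "(real^'m) set \<Rightarrow> nat \<Rightarrow> (nat \<Rightarrow> real^'n \<Rightarrow> real^'m) \<Rightarrow> (nat \<Rightarrow> real^'n \<Rightarrow> (real^'m) cext) \<Rightarrow>
     real \<Rightarrow> real \<Rightarrow> real^'n \<Rightarrow> (nat \<Rightarrow> nat) \<Rightarrow> real^'n \<Rightarrow> real \<Rightarrow> bool" where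
  "line_search_step C p f g \<rho> \<mu> x a v \<alpha> \<longleftrightarrow>
     (\<exists>i::nat. \<alpha> = \<mu> ^ i \<and> sufficient_decrease C p f g \<rho> x a v (\<mu> ^ i)
        \<and> (\<forall>i'<i. \<not> sufficient_decrease C p f g \<rho> x a v (\<mu> ^ i')))"

definition prox_grad_sequence ::
  "(real^'m) set \<Rightarrow> nat \<Rightarrow> (nat \<Rightarrow> real^'n \<Rightarrow> real^'m) \<Rightarrow> (nat \<Rightarrow> real^'n \<Rightarrow> (real^'m) cext) \<Rightarrow>
     (real^'n \<Rightarrow> nat \<Rightarrow> (real^'m) cext) \<Rightarrow> real \<Rightarrow> real \<Rightarrow> real \<Rightarrow> real^'n \<Rightarrow>
     (nat \<Rightarrow> real^'n) \<Rightarrow> (nat \<Rightarrow> nat \<Rightarrow> nat) \<Rightarrow> (nat \<Rightarrow> real^'n) \<Rightarrow> (nat \<Rightarrow> real) \<Rightarrow> bool" where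
  "prox_grad_sequence C p f g u \<rho> \<mu> l x0 x a v \<alpha> \<longleftrightarrow>
     x 0 = x0 \<and>
     (\<forall>k. is_arg_min (prox_objective C p f g l (x k))
            (\<lambda>(b, w). b \<in> partition_set C p (hfun f g) u (x k)) (a k, v k)
        \<and> line_search_step C p f g \<rho> \<mu> (x k) (a k) (v k) (\<alpha> k)
        \<and> x (Suc k) = x k + \<alpha> k *\<^sub>R v k)"

end

theory Submission
  imports Defs
begin

text \<open>
  Suppose \<open>norm (v k) > \<epsilon>\<close> for all \<open>k\<close>.  Comparing the proximal minimiser with \<open>v = 0\<close> shows that
  along every \<open>z\<close> of the dual sphere the model decreases by at least \<open>l / 2 * (norm (v k))\<^sup>2\<close>.  Fix one
  such \<open>z\<close>: the minimum of \<open>z\<close> over \<open>H (x k)\<close> then drops by \<open>\<rho> * \<alpha> k * l / 2 * (norm (v k))\<^sup>2\<close> in every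
  step, and it is bounded below because \<open>H (x k)\<close> is a chain for the set order; hence
  \<open>\<Sum>k. \<alpha> k * (norm (v k))\<^sup>2 < \<infinity>\<close>.  As \<open>norm (v k) > \<epsilon>\<close>, also \<open>\<Sum>k. \<alpha> k * norm (v k)\<close> and \<open>\<Sum>k. \<alpha> k\<close>
  are finite, so \<open>x k\<close> converges although no level set is assumed bounded, and \<open>\<alpha> k \<longlonglongrightarrow> 0\<close>,
  \<open>\<alpha> k *\<^sub>R v k \<longlonglongrightarrow> 0\<close>.  Near the limit point the functions \<open>f j\<close> are linearised with an error
  \<open>o(\<alpha> k * norm (v k))\<close>, uniformly in \<open>k\<close>; by convexity of \<open>g j\<close> and the bipolar theorem the trial step
  \<open>\<alpha> k / \<mu>\<close>, which the line search has rejected, is acceptable for large \<open>k\<close>: a contradiction.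
\<close>

section \<open>Separation by unit functionals of the dual cone\<close>

text \<open>Strict separation gives \<open>w\<close> with \<open>w \<bullet> c > b\<close> on
  \<open>C\<close>, and \<open>b < 0\<close> because \<open>C\<close> contains 0. Homogeneity
  improves this to nonnegativity on \<open>C\<close>; normalising then puts \<open>w\<close> on the
  dual sphere.\<close>

lemma dual_sphere_separation:
  fixes C :: "'a::euclidean_space set"
  assumes "closed C" "convex_cone C" "y \<notin> C"
  shows "\<exists>z\<in>dual_sphere C. z \<bullet> y < 0"
proof -
  obtain w b where wb: "w \<bullet> y < b" "\<forall>c\<in>C. w \<bullet> c > b"
    using separating_hyperplane_closed_point[of C y] assms by (auto simp: convex_cone_def)
  have "b < 0"
    using wb(2) convex_cone_contains_0[OF assms(2)] by force
  have pos: "0 \<le> w \<bullet> c" if "c \<in> C" for c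
  proof (rule ccontr)
    assume neg: "\<not> 0 \<le> w \<bullet> c"
    \<comment> \<open>The factor makes the functional \<open>w\<close> take exactly the value
      \<open>b\<close>, which strict separation forbids.\<close>
    have "(b / (w \<bullet> c)) *\<^sub>R c \<in> C"
      using neg \<open>b < 0\<close> that by (intro convex_cone_scaleR[OF assms(2)]) (auto simp: divide_nonpos_neg)
    then have "w \<bullet> ((b / (w \<bullet> c)) *\<^sub>R c) > b"
      using wb(2) by blast
    then show False
      using neg by simp
  qed
  have "w \<noteq> 0"
    using wb(1) \<open>b < 0\<close> by auto
  then have "w /\<^sub>R norm w \<in> dual_sphere C"
    using pos by (auto simp: dual_sphere_def dual_cone_def inner_commute)
  moreover have "(w /\<^sub>R norm w) \<bullet> y < 0"
    using \<open>w \<noteq> 0\<close> wb(1) \<open>b < 0\<close> by (simp add: mult_pos_neg)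
  ultimately show ?thesis
    by blast
qed

text \<open>The nontrivial half of the bipolar theorem: it turns scalar estimates valid for every
  \<open>z\<close> back into cone inequalities.\<close>

lemma mem_cone_if_dual_sphere_nonneg:
  fixes C :: "'a::euclidean_space set"
  assumes "closed C" "convex_cone C" "\<And>z. z \<in> dual_sphere C \<Longrightarrow> 0 \<le> z \<bullet> y"
  shows "y \<in> C"
  using dual_sphere_separation[OF assms(1,2)] assms(3) by force

text \<open>A pointed cone cannot contain both \<open>b\<close> and \<open>- b\<close> for
  \<open>b \<noteq> 0\<close>, so some point lies outside \<open>C\<close> and can be separated from
  it.\<close>

lemma dual_sphere_nonempty:
  fixes C :: "'a::euclidean_space set"
  assumes "closed C" "convex_cone C" "pointed C"
  shows "dual_sphere C \<noteq> {}"
proof -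
  obtain b :: 'a where "b \<in> Basis"
    using nonempty_Basis by blast
  then have "b \<noteq> 0"
    by auto
  then have "b \<notin> C \<inter> uminus ` C"
    using assms(3) by (auto simp: pointed_def)
  then have "b \<notin> C \<or> - b \<notin> C"
    by (metis IntI image_eqI minus_minus)
  then show ?thesis
    using dual_sphere_separation[OF assms(1,2)] by blast
qed

lemma dual_sphere_inner_nonneg: "z \<in> dual_sphere C \<Longrightarrow> c \<in> C \<Longrightarrow> 0 \<le> z \<bullet> c"
  by (auto simp: dual_sphere_def dual_cone_def inner_commute)

text \<open>Only an inequality, since the supremum over an empty dual sphere would be
  \<open>- \<infinity>\<close>.\<close>

lemma phi_Vec_zero_le: "phi C (Vec 0) \<le> 0"
  by (auto intro!: SUP_least simp: zero_ereal_def)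

lemma phi_leD:
  assumes "phi C w \<le> ereal c"
  shows "\<exists>y. w = Vec y \<and> (\<forall>z\<in>dual_sphere C. z \<bullet> y \<le> c)"
proof (cases w)
  case (Vec y)
  have "z \<bullet> y \<le> c" if "z \<in> dual_sphere C" for z
    using assms that unfolding Vec phi.simps SUP_le_iff by force
  then show ?thesis
    using Vec by blast
qed (use assms in simp)

section \<open>Cone order and minimal elements\<close>

lemma cone_le_refl: "0 \<in> C \<Longrightarrow> cone_le C w w"
  by (cases w) auto

lemma cone_le_trans:
  assumes "convex_cone C" "cone_le C u v" "cone_le C v w"
  shows "cone_le C u w"
proof (cases u; cases v; cases w)
  fix a b c assume "u = Vec a" "v = Vec b" "w = Vec c"
  then show ?thesis
    using assms convex_cone_add[OF assms(1), of "b - a" "c - b"] by simp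
qed (use assms in auto)

lemma cone_le_antisym:
  assumes "pointed C" "cone_le C u v" "cone_le C v u"
  shows "u = v"
proof (cases u; cases v)
  fix a b assume ab: "u = Vec a" "v = Vec b"
  then have "b - a \<in> C \<inter> uminus ` C"
    using assms by (auto intro!: image_eqI[of _ _ "a - b"])
  then have "b - a = 0"
    using assms(1) unfolding pointed_def by blast
  then show ?thesis
    using ab by simp
qed (use assms in auto)

text \<open>Induction on the number of elements of \<open>U\<close> below \<open>w\<close>: passing
  to some \<open>w' \<noteq> w\<close> below \<open>w\<close> discards at least \<open>w\<close>
  itself, by antisymmetry.\<close>

lemma minimal_set_dominates:
  assumes C: "convex_cone C" "pointed C" and "finite U" "w \<in> U"
  shows "\<exists>w'\<in>minimal_set C U. cone_le C w' w"
  using \<open>w \<in> U\<close>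
proof (induction "card {y \<in> U. cone_le C y w}" arbitrary: w rule: less_induct)
  case less
  show ?case
  proof (cases "w \<in> minimal_set C U")
    case True
    then show ?thesis
      using cone_le_refl convex_cone_contains_0 C by blast
  next
    case False
    then obtain w' where w': "w' \<in> U" "w' \<noteq> w" "cone_le C w' w"
      using less.prems by (auto simp: minimal_set_def)
    have "{y \<in> U. cone_le C y w'} \<subset> {y \<in> U. cone_le C y w}"
      using w' less.prems cone_le_trans[OF C(1)] cone_le_antisym[OF C(2)]
        cone_le_refl convex_cone_contains_0[OF C(1)] by blast
    then have "card {y \<in> U. cone_le C y w'} < card {y \<in> U. cone_le C y w}"
      using \<open>finite U\<close> by (intro psubset_card_mono) auto
    then show ?thesis
      using less.hyps w' cone_le_trans[OF C(1)] by blast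
  qed
qed

section \<open>Descent in one iteration of the method\<close>

lemma domH_finite: "x \<in> domH C p h \<Longrightarrow> j \<in> {1..p} \<Longrightarrow> \<exists>y. h j x = Vec y"
  by (cases "h j x") (force simp: domH_def)+

lemma hfun_eq_Vec_iff: "hfun f g j x = Vec y \<longleftrightarrow> g j x = Vec (y - f j x)"
  for y :: "'a::ab_group_add"
  by (cases "g j x") (auto simp: hfun_def)

lemma partition_set_index:
  assumes "b \<in> partition_set C p h u x" "j \<in> {1..omega C p h x}"
  shows "b j \<in> {1..p}" "h (b j) x = u x j"
  using PiE_mem[OF assms[unfolded partition_set_def]] by (auto simp: active_def)

text \<open>The pair \<open>(a, 0)\<close> competes in the minimisation and has objective at most 0,
  because the model vanishes there. Bounding the maximum at the minimiser bounds each of its terms,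
  and a finite bound on \<open>phi\<close> excludes \<open>Top\<close>.\<close>

lemma prox_model_le:
  assumes min: "is_arg_min (prox_objective C p f g l x)
      (\<lambda>(b, w). b \<in> partition_set C p (hfun f g) u x) (a, v)"
    and x: "x \<in> domH C p (hfun f g)"
    and j: "j \<in> {1..omega C p (hfun f g) x}"
  shows "\<exists>y. model (f (a j)) (g (a j)) x v = Vec y \<and>
    (\<forall>z\<in>dual_sphere C. z \<bullet> y \<le> - (l / 2 * (norm v)\<^sup>2))"
proof (rule phi_leD)
  let ?J = "{1..omega C p (hfun f g) x}"
  let ?m = "\<lambda>v j. phi C (model (f (a j)) (g (a j)) x v)"
  have a: "a \<in> partition_set C p (hfun f g) u x"
    using min by (simp add: is_arg_min_def)
  have "?m 0 i \<le> 0" if i: "i \<in> ?J" for i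
  proof -
    obtain y where "hfun f g (a i) x = Vec y"
      using domH_finite[OF x partition_set_index(1)[OF a i]] by blast
    then have "g (a i) x = Vec (y - f (a i) x)"
      by (simp only: hfun_eq_Vec_iff)
    then have "model (f (a i)) (g (a i)) x 0 = Vec 0"
      by (simp add: model_def)
    then show ?thesis
      using phi_Vec_zero_le by metis
  qed
  \<comment> \<open>The index \<open>j\<close> witnesses nonemptiness, without which
    \<open>Max\<close> is unspecified.\<close>
  moreover have fin: "finite (?m w ` ?J)" and ne: "?m w ` ?J \<noteq> {}" for w
    using j by auto
  ultimately have "Max (?m 0 ` ?J) \<le> 0"
    by (subst Max_le_iff[OF fin ne]) blast
  then have "prox_objective C p f g l x (a, 0) \<le> 0"
    by (simp add: prox_objective_def flip: zero_ereal_def)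
  moreover have "\<not> prox_objective C p f g l x (a, 0) < prox_objective C p f g l x (a, v)"
    using min a by (auto simp: is_arg_min_def)
  ultimately have "Max (?m v ` ?J) + ereal (l / 2 * (norm v)\<^sup>2) \<le> 0"
    by (auto simp: prox_objective_def)
  moreover have "?m v j \<le> Max (?m v ` ?J)"
    using j fin by (intro Max_ge) auto
  ultimately have "?m v j + ereal (l / 2 * (norm v)\<^sup>2) \<le> 0"
    by (meson add_right_mono order_trans)
  then show "?m v j \<le> ereal (- (l / 2 * (norm v)\<^sup>2))"
    by (cases "?m v j") auto
qed

text \<open>The line search controls only the functions selected by \<open>a\<close>, one for each
  minimal value. An arbitrary value \<open>w\<close> lies above some minimal value, and the function
  selected for that one supplies \<open>w'\<close>. The same \<open>w'\<close> serves all
  \<open>z\<close>, as the set order will require.\<close>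

lemma sufficient_decrease_set_le:
  assumes C: "convex_cone C" "pointed C"
    and enum: "enumerates_minimal C p (hfun f g) u"
    and a: "a \<in> partition_set C p (hfun f g) u x"
    and dec: "sufficient_decrease C p f g \<rho> x a v t"
    and y: "\<And>j. j \<in> {1..omega C p (hfun f g) x} \<Longrightarrow>
      \<exists>y. model (f (a j)) (g (a j)) x v = Vec y \<and> (\<forall>z\<in>dual_sphere C. z \<bullet> y \<le> - c)"
    and t: "0 \<le> \<rho> * t"
    and w: "Vec w \<in> Hmap p (hfun f g) x"
  shows "\<exists>w'. Vec w' \<in> Hmap p (hfun f g) (x + t *\<^sub>R v) \<and>
    (\<forall>z\<in>dual_sphere C. z \<bullet> w' \<le> z \<bullet> w - \<rho> * t * c)"
proof -
  have "finite (Hmap p (hfun f g) x)"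
    by (simp add: Hmap_def)
  then obtain m where m: "m \<in> minimal_set C (Hmap p (hfun f g) x)" "cone_le C m (Vec w)"
    using minimal_set_dominates[OF C _ w] by blast
  then obtain j where j: "j \<in> {1..omega C p (hfun f g) x}" "m = u x j"
    using enum unfolding enumerates_minimal_def bij_betw_def by blast
  obtain m' where m': "m = Vec m'"
    using m(2) by (cases m) auto
  obtain y where y: "model (f (a j)) (g (a j)) x v = Vec y" "\<forall>z\<in>dual_sphere C. z \<bullet> y \<le> - c"
    using y j(1) by blast
  have aj: "a j \<in> {1..p}" "hfun f g (a j) x = Vec m'"
    using partition_set_index[OF a j(1)] j(2) m' by auto
  have "cone_le C (hfun f g (a j) (x + t *\<^sub>R v)) (Vec (m' + (\<rho> * t) *\<^sub>R y))"
    using dec j(1) aj(2) y(1) unfolding sufficient_decrease_def by (metis plus_cext.simps(1) scaleR_cext.simps(1))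
  then obtain w' where w': "hfun f g (a j) (x + t *\<^sub>R v) = Vec w'" "m' + (\<rho> * t) *\<^sub>R y - w' \<in> C"
    by (cases "hfun f g (a j) (x + t *\<^sub>R v)") auto
  have "z \<bullet> w' \<le> z \<bullet> w - \<rho> * t * c" if z: "z \<in> dual_sphere C" for z
  proof -
    have "0 \<le> z \<bullet> (m' + (\<rho> * t) *\<^sub>R y - w')" "0 \<le> z \<bullet> (w - m')"
      using dual_sphere_inner_nonneg[OF z] w'(2) m(2) m' by auto
    moreover have "(\<rho> * t) * (z \<bullet> y) \<le> (\<rho> * t) * (- c)"
      using y(2) z t by (intro mult_left_mono) auto
    ultimately show ?thesis
      by (simp add: inner_simps)
  qed
  moreover have "Vec w' \<in> Hmap p (hfun f g) (x + t *\<^sub>R v)"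
    using aj(1) w'(1) unfolding Hmap_def by (metis image_eqI)
  ultimately show ?thesis
    by blast
qed

section \<open>Uniform linearisation and acceptance of short steps\<close>

lemma norm_transpose_mult_le:
  fixes N :: "real^'m^'n"
  shows "norm (transpose N *v d) \<le> real CARD('n) * norm N * norm d"
proof -
  have "transpose N *v d = (\<Sum>i\<in>UNIV. (d $ i) *\<^sub>R (N $ i))"
    by (simp add: vec_eq_iff matrix_vector_mult_def transpose_def mult.commute)
  then have "norm (transpose N *v d) \<le> (\<Sum>i\<in>UNIV. norm ((d $ i) *\<^sub>R (N $ i)))"
    using norm_sum[of "\<lambda>i. (d $ i) *\<^sub>R (N $ i)" UNIV] by (simp only:)
  also have "\<dots> \<le> (\<Sum>i\<in>(UNIV::'n set). norm N * norm d)"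
  proof (rule sum_mono)
    fix i :: 'n
    show "norm ((d $ i) *\<^sub>R (N $ i)) \<le> norm N * norm d"
      using mult_mono[OF Finite_Cartesian_Product.norm_nth_le[of d i] Finite_Cartesian_Product.norm_nth_le[of N i]] by (simp add: mult.commute)
  qed
  finally show ?thesis
    by simp
qed

text \<open>The mean value inequality on a ball around \<open>c\<close> where the derivative
  oscillates by at most \<open>\<eta>\<close>. The radius does not depend on the base point
  \<open>y\<close>, so it can serve all late iterates at once.\<close>

lemma C1_uniform_linearization:
  fixes f :: "real^'n \<Rightarrow> real^'m"
  assumes "C1 f" "\<eta> > 0"
  shows "\<exists>r>0. \<forall>y d. dist y c < r \<and> norm d < r \<longrightarrow>
    norm (f (y + d) - f y - transpose (nabla f y) *v d) \<le> \<eta> * norm d"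
proof -
  define D where "D y = (\<lambda>h. transpose (nabla f y) *v h)" for y
  define K where "K = real CARD('n)"
  have K: "K > 0"
    by (simp add: K_def)
  have D: "(f has_derivative D y) (at y within S)" for y S
    using assms(1) jacobian_works[of f "at y"]
    by (auto simp: C1_def D_def nabla_def has_derivative_at_withinI)
  have "isCont (nabla f) c"
    using assms(1) by (simp add: C1_def continuous_on_eq_continuous_at)
  moreover have "\<eta> / (2 * K) > 0"
    using assms(2) K by simp
  \<comment> \<open>The 2 pays for comparing two points of the ball through \<open>c\<close>, and
    \<open>K\<close> for passing from the matrix norm to the operator norm.\<close>
  ultimately obtain s where s: "s > 0" "\<And>y. dist y c < s \<Longrightarrow> dist (nabla f y) (nabla f c) < \<eta> / (2 * K)"
    unfolding continuous_at_eps_delta by metis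
  have bound: "onorm (\<lambda>h. D y h - D y' h) \<le> \<eta>" if "dist y c < s" "dist y' c < s" for y y'
  proof (rule onorm_le)
    fix h :: "real^'n"
    have "dist (nabla f y) (nabla f y') \<le> \<eta> / (2 * K) + \<eta> / (2 * K)"
      using s(2)[OF that(1)] s(2)[OF that(2)] dist_triangle2[of "nabla f y" "nabla f y'" "nabla f c"] by linarith
    then have "norm (nabla f y - nabla f y') \<le> \<eta> / K"
      by (simp add: dist_norm)
    then have "K * norm (nabla f y - nabla f y') * norm h \<le> \<eta> * norm h"
      using K by (intro mult_right_mono) (auto simp: field_simps)
    moreover have "D y h - D y' h = transpose (nabla f y - nabla f y') *v h"
      by (simp add: D_def vec_eq_iff matrix_vector_mult_def transpose_def algebra_simps sum_subtractf)
    ultimately show "norm (D y h - D y' h) \<le> \<eta> * norm h"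
      using norm_transpose_mult_le[of "nabla f y - nabla f y'" h] by (simp add: K_def)
  qed
  \<comment> \<open>Halving the radius keeps the segment from \<open>y\<close> to
    \<open>y + d\<close> inside the ball of radius \<open>s\<close>.\<close>
  have "norm (f (y + d) - f y - D y d) \<le> \<eta> * norm d" if "dist y c < s / 2" "norm d < s / 2" for y d :: "real^'n"
  proof -
    have "norm (f (y + d) - f y - D y ((y + d) - y)) \<le> norm ((y + d) - y) * \<eta>"
    proof (rule differentiable_bound_linearization[where S = "{y. dist y c < s}" and f' = D])
      fix t :: real assume "t \<in> {0..1}"
      then have "t * norm d \<le> norm d"
        by (simp add: mult_left_le_one_le)
      moreover have "dist (y + t *\<^sub>R d) c \<le> dist y c + \<bar>t\<bar> * norm d"
        using norm_triangle_ineq[of "y - c" "t *\<^sub>R d"] by (simp add: dist_norm algebra_simps)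
      ultimately show "y + t *\<^sub>R (y + d - y) \<in> {y. dist y c < s}"
        using that \<open>t \<in> {0..1}\<close> by auto
    qed (use that D s(1) bound in \<open>auto simp: fun_diff_def\<close>)
    then show ?thesis
      by (simp add: mult.commute)
  qed
  then show ?thesis
    using s(1) unfolding D_def by (intro exI[of _ "s / 2"]) auto
qed

text \<open>Demanding only the fraction \<open>\<rho>\<close> of the model decrease leaves a reserve
  of \<open>(1 - \<rho>) * t * (l / 2) * (norm v)\<^sup>2\<close> along every \<open>z\<close>. The
  bound on \<open>\<eta>\<close> makes this reserve cover the linearisation error.\<close>

lemma decrease_of_small_step:
  fixes C :: "(real^'m) set" and v :: "real^'n"
  assumes C: "closed C" "convex_cone C"
    and conv: "C_convex C (g j)"
    and hx: "hfun f g j x = Vec w"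
    and model: "model (f j) (g j) x v = Vec y"
    and y: "\<And>z. z \<in> dual_sphere C \<Longrightarrow> z \<bullet> y \<le> - (l / 2 * (norm v)\<^sup>2)"
    and t: "0 < t" "t \<le> 1" and "\<rho> < 1"
    and lin: "norm (f j (x + t *\<^sub>R v) - f j x - transpose (nabla (f j) x) *v (t *\<^sub>R v)) \<le> \<eta> * norm (t *\<^sub>R v)"
    and \<eta>: "\<eta> \<le> (1 - \<rho>) * (l / 2) * norm v"
  shows "cone_le C (hfun f g j (x + t *\<^sub>R v)) (hfun f g j x + (\<rho> * t) *\<^sub>R model (f j) (g j) x v)"
proof -
  define J where "J = transpose (nabla (f j) x) *v v"
  obtain gx where gx: "g j x = Vec gx" "w = f j x + gx"
    using that[of "w - f j x"] hx by (simp add: hfun_eq_Vec_iff)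
  obtain gv where gv: "g j (x + v) = Vec gv" "y = J + gv - gx"
    using model gx(1) unfolding model_def J_def by (cases "g j (x + v)") auto
  have "x + t *\<^sub>R v = t *\<^sub>R (x + v) + (1 - t) *\<^sub>R x"
    by (simp add: algebra_simps)
  then have "cone_le C (g j (x + t *\<^sub>R v)) (t *\<^sub>R Vec gv + (1 - t) *\<^sub>R Vec gx)"
    using conv t unfolding C_convex_def
    by (metis greaterThanAtMost_iff gv(1) gx(1))
  then obtain gt where gt: "g j (x + t *\<^sub>R v) = Vec gt" "t *\<^sub>R gv + (1 - t) *\<^sub>R gx - gt \<in> C"
    by (cases "g j (x + t *\<^sub>R v)") auto
  define r where "r = f j (x + t *\<^sub>R v) - f j x - t *\<^sub>R J"
  have r: "norm r \<le> \<eta> * (t * norm v)"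
    using lin t by (simp add: r_def J_def matrix_vector_mult_scaleR)
  have "w + (\<rho> * t) *\<^sub>R y - (f j (x + t *\<^sub>R v) + gt) \<in> C"
  proof (rule mem_cone_if_dual_sphere_nonneg[OF C])
    fix z assume z: "z \<in> dual_sphere C"
    \<comment> \<open>The three terms are the convexity slack, which lies in \<open>C\<close>, the
      reserve and the linearisation error.\<close>
    have "w + (\<rho> * t) *\<^sub>R y - (f j (x + t *\<^sub>R v) + gt)
        = (t *\<^sub>R gv + (1 - t) *\<^sub>R gx - gt) - ((1 - \<rho>) * t) *\<^sub>R y - r"
      by (simp add: gx(2) gv(2) r_def algebra_simps)
    then have "z \<bullet> (w + (\<rho> * t) *\<^sub>R y - (f j (x + t *\<^sub>R v) + gt))
        = z \<bullet> (t *\<^sub>R gv + (1 - t) *\<^sub>R gx - gt) - ((1 - \<rho>) * t) * (z \<bullet> y) - z \<bullet> r"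
      by (simp only: inner_diff_right inner_scaleR_right)
    moreover have "0 \<le> z \<bullet> (t *\<^sub>R gv + (1 - t) *\<^sub>R gx - gt)"
      using dual_sphere_inner_nonneg z gt(2) .
    moreover have "((1 - \<rho>) * t) * (z \<bullet> y) \<le> ((1 - \<rho>) * t) * (- (l / 2 * (norm v)\<^sup>2))"
      using y[OF z] t \<open>\<rho> < 1\<close> by (intro mult_left_mono) auto
    moreover have "z \<bullet> r \<le> norm r"
      using norm_cauchy_schwarz[of z r] z by (simp add: dual_sphere_def)
    moreover have "\<eta> * (t * norm v) \<le> ((1 - \<rho>) * (l / 2) * norm v) * (t * norm v)"
      using \<eta> t by (intro mult_right_mono) auto
    ultimately show "0 \<le> z \<bullet> (w + (\<rho> * t) *\<^sub>R y - (f j (x + t *\<^sub>R v) + gt))"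
      using r by (simp only: power2_eq_square) (simp add: mult_ac)
  qed
  then show ?thesis
    using hx model gt(1) by (simp add: hfun_def)
qed

lemma summable_of_descent:
  fixes m b :: "nat \<Rightarrow> real"
  assumes "\<And>k. m (Suc k) \<le> m k - b k" "\<And>k. 0 \<le> b k" "\<And>k. L \<le> m k"
  shows "summable b"
proof (rule summableI_nonneg_bounded)
  fix n
  have "sum b {..<n} \<le> m 0 - m n"
  proof (induction n)
    case (Suc n)
    then show ?case
      using assms(1)[of n] by simp
  qed simp
  then show "sum b {..<n} \<le> m 0 - L"
    using assms(3)[of n] by linarith
qed (fact assms)

section \<open>Contradiction from directions bounded away from zero\<close>

theorem theorem5p1:
  fixes C :: "(real^'m) set"
    and p :: nat
    and f :: "nat \<Rightarrow> real^'n \<Rightarrow> real^'m"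
    and g :: "nat \<Rightarrow> real^'n \<Rightarrow> (real^'m) cext"
    and u :: "real^'n \<Rightarrow> nat \<Rightarrow> (real^'m) cext"
    and \<rho> \<mu> l \<epsilon> :: real
    and x0 :: "real^'n"
    and x v :: "nat \<Rightarrow> real^'n"
    and a :: "nat \<Rightarrow> nat \<Rightarrow> nat"
    and \<alpha> :: "nat \<Rightarrow> real"
  assumes "closed C" "convex_cone C" "pointed C" "interior C \<noteq> {}"
    and "p \<ge> 1"
    and "\<And>j. j \<in> {1..p} \<Longrightarrow> C1 (f j)"
    and "\<And>j. j \<in> {1..p} \<Longrightarrow> proper (g j) \<and> C_closed C (g j) \<and> C_convex C (g j)"
    and "x0 \<in> domH C p (hfun f g)"
    and "chains_bounded_below C p (hfun f g) x0"
    and "enumerates_minimal C p (hfun f g) u"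
    and "0 < \<rho>" "\<rho> < 1" "0 < \<mu>" "\<mu> < 1" "l > 0"
    and "prox_grad_sequence C p f g u \<rho> \<mu> l x0 x a v \<alpha>"
    and "\<And>k. x k \<in> domH C p (hfun f g)"
    and "\<And>k. \<not> stationary C p (hfun f g) u (x k)"
    and "\<epsilon> > 0"
  shows "\<exists>k. norm (v k) \<le> \<epsilon>"
proof (rule ccontr)
  assume "\<nexists>k. norm (v k) \<le> \<epsilon>"
  then have big: "\<epsilon> < norm (v k)" for k
    by (meson not_le)
  note C = assms(1-3) and dom = assms(17)
  define H where "H k = Hmap p (hfun f g) (x k)" for k
  define q where "q k = l / 2 * (norm (v k))\<^sup>2" for k
  have x_0: "x 0 = x0"
    and argmin: "\<And>k. is_arg_min (prox_objective C p f g l (x k))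
      (\<lambda>(b, w). b \<in> partition_set C p (hfun f g) u (x k)) (a k, v k)"
    and ls: "\<And>k. line_search_step C p f g \<rho> \<mu> (x k) (a k) (v k) (\<alpha> k)"
    and x_Suc: "\<And>k. x (Suc k) = x k + \<alpha> k *\<^sub>R v k"
    using assms(16) by (auto simp: prox_grad_sequence_def)
  have part: "a k \<in> partition_set C p (hfun f g) u (x k)" for k
    using argmin[of k] by (simp add: is_arg_min_def)
  have model: "\<exists>y. model (f (a k j)) (g (a k j)) (x k) (v k) = Vec y \<and>
      (\<forall>z\<in>dual_sphere C. z \<bullet> y \<le> - q k)"
    if "j \<in> {1..omega C p (hfun f g) (x k)}" for k j
    using prox_model_le[OF argmin dom that] by (simp add: q_def)
  have \<alpha>: "0 < \<alpha> k" and dec: "sufficient_decrease C p f g \<rho> (x k) (a k) (v k) (\<alpha> k)" for k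
    using ls[of k] assms(13) by (auto simp: line_search_step_def)
  have q: "0 \<le> q k" for k
    using assms(15) by (simp add: q_def)
  have descent: "\<exists>w'. Vec w' \<in> H (Suc k) \<and> (\<forall>z\<in>dual_sphere C. z \<bullet> w' \<le> z \<bullet> w - \<rho> * \<alpha> k * q k)"
    if "Vec w \<in> H k" for k w
    using sufficient_decrease_set_le[OF C(2,3) assms(10) part dec model _ that[unfolded H_def]]
      \<alpha>[of k] assms(11) by (simp add: H_def x_Suc)
  have H_Vec: "\<exists>y. w = Vec y" if "w \<in> H k" for w k
    using that domH_finite[OF dom] by (auto simp: H_def Hmap_def)
  \<comment> \<open>Since \<open>descent\<close> gives one \<open>w'\<close> for all
    \<open>z\<close>, the scalar inequalities combine into a cone inequality.\<close>
  have H_Suc: "set_le C (H (Suc k)) (H k)" for k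
    unfolding set_le_def
  proof
    fix w assume w: "w \<in> H k"
    then obtain y where y: "w = Vec y"
      using H_Vec by blast
    then obtain w' where w': "Vec w' \<in> H (Suc k)" "\<forall>z\<in>dual_sphere C. z \<bullet> w' \<le> z \<bullet> y - \<rho> * \<alpha> k * q k"
      using descent w by blast
    have "0 \<le> \<rho> * \<alpha> k * q k"
      using assms(11) \<alpha>[of k] q[of k] by simp
    then have "y - w' \<in> C"
      using w'(2) by (intro mem_cone_if_dual_sphere_nonneg[OF C(1,2)]) (force simp: inner_diff_right)
    then show "\<exists>u\<in>H (Suc k). cone_le C u w"
      using w'(1) y by (intro bexI[of _ "Vec w'"]) auto
  qed
  \<comment> \<open>Transitivity places all iterates in the level set, so the boundedness assumption
    applies to the chain \<open>H\<close>.\<close>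
  have "set_le C (H k) (H 0)" for k
  proof (induction k)
    case 0
    then show ?case
      using cone_le_refl convex_cone_contains_0[OF C(2)] by (auto simp: set_le_def)
  next
    case (Suc k)
    then show ?case
      using H_Suc[of k] cone_le_trans[OF C(2)] unfolding set_le_def by meson
  qed
  then have "H k \<in> Hmap p (hfun f g) ` level_set C p (hfun f g) x0" for k
    by (auto simp: H_def level_set_def x_0)
  then obtain B where B: "bounded B" "\<And>k. set_le C (Vec ` B) (H k)"
    using assms(9) H_Suc unfolding chains_bounded_below_def by metis
  obtain z where z: "z \<in> dual_sphere C"
    using dual_sphere_nonempty[OF C] by blast
  define Z where "Z k = {z \<bullet> y |y. Vec y \<in> H k}" for k
  have Z_fin: "finite (Z k)" for k
  proof -
    have "finite (Vec -` H k)"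
      by (intro finite_vimageI) (auto simp: H_def Hmap_def inj_def)
    moreover have "Z k = (\<lambda>y. z \<bullet> y) ` (Vec -` H k)"
      by (auto simp: Z_def)
    ultimately show ?thesis
      by simp
  qed
  have Z_ne: "Z k \<noteq> {}" for k
  proof -
    have "hfun f g 1 (x k) \<in> H k"
      using assms(5) by (auto simp: H_def Hmap_def)
    then show ?thesis
      using H_Vec[of "hfun f g 1 (x k)" k] by (auto simp: Z_def)
  qed
  obtain L where L: "\<And>b. b \<in> B \<Longrightarrow> norm b \<le> L"
    using B(1) by (auto simp: bounded_iff)
  have "summable (\<lambda>k. \<rho> * \<alpha> k * q k)"
  proof (rule summable_of_descent)
    fix k
    show "Min (Z (Suc k)) \<le> Min (Z k) - \<rho> * \<alpha> k * q k"
    proof -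
      obtain y where y: "Vec y \<in> H k" "Min (Z k) = z \<bullet> y"
        using Min_in[OF Z_fin Z_ne, of k] by (auto simp: Z_def)
      then obtain w' where w': "Vec w' \<in> H (Suc k)" "z \<bullet> w' \<le> z \<bullet> y - \<rho> * \<alpha> k * q k"
        using descent z by blast
      then have "Min (Z (Suc k)) \<le> z \<bullet> w'"
        using Z_fin by (intro Min_le) (auto simp: Z_def)
      then show ?thesis
        using w' y by simp
    qed
    show "0 \<le> \<rho> * \<alpha> k * q k"
      using assms(11) \<alpha>[of k] q[of k] by simp
    obtain y where y: "Vec y \<in> H k" "Min (Z k) = z \<bullet> y"
      using Min_in[OF Z_fin Z_ne, of k] by (auto simp: Z_def)
    then obtain b where b: "b \<in> B" "y - b \<in> C"
      using B(2)[of k] unfolding set_le_def by force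
    \<comment> \<open>Cauchy-Schwarz with \<open>norm z = 1\<close>; the bound \<open>L\<close> is
      uniform in \<open>k\<close> because one set \<open>B\<close> lies below the whole
      chain.\<close>
    have "- L \<le> z \<bullet> b"
      using L[OF b(1)] Cauchy_Schwarz_ineq2[of z b] z by (auto simp: dual_sphere_def)
    also have "\<dots> \<le> z \<bullet> y"
      using dual_sphere_inner_nonneg[OF z b(2)] by (simp add: inner_diff_right)
    finally show "- L \<le> Min (Z k)"
      using y by simp
  qed
  then have sum_q: "summable (\<lambda>k. \<alpha> k * (norm (v k))\<^sup>2)"
    using summable_mult[of "\<lambda>k. \<rho> * \<alpha> k * q k" "2 / (\<rho> * l)"] assms(11,15)
    by (simp add: q_def field_simps)
  \<comment> \<open>Each factor \<open>norm (v k)\<close> may be dropped at the cost of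
    \<open>1 / \<epsilon>\<close>, here and once more for \<open>sum_\<alpha>\<close>.\<close>
  have sum_v: "summable (\<lambda>k. \<alpha> k * norm (v k))"
  proof (rule summable_comparison_test')
    show "summable (\<lambda>k. 1 / \<epsilon> * (\<alpha> k * (norm (v k))\<^sup>2))"
      using sum_q by (rule summable_mult)
    show "norm (\<alpha> k * norm (v k)) \<le> 1 / \<epsilon> * (\<alpha> k * (norm (v k))\<^sup>2)" for k
      using mult_right_mono[OF less_imp_le[OF big[of k]], of "norm (v k)"] assms(19) \<alpha>[of k]
      by (simp add: field_simps power2_eq_square abs_mult)
  qed
  have sum_\<alpha>: "summable \<alpha>"
  proof (rule summable_comparison_test')
    show "summable (\<lambda>k. 1 / \<epsilon> * (\<alpha> k * norm (v k)))"
      using sum_v by (rule summable_mult)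
    show "norm (\<alpha> k) \<le> 1 / \<epsilon> * (\<alpha> k * norm (v k))" for k
      using big[of k] assms(19) \<alpha>[of k] by (simp add: field_simps)
  qed
  \<comment> \<open>The increments converge absolutely, and their partial sums telescope to
    \<open>x n - x 0\<close>.\<close>
  have "summable (\<lambda>k. \<alpha> k *\<^sub>R v k)"
    by (rule summable_norm_cancel) (use sum_v \<alpha> in \<open>simp add: abs_of_pos\<close>)
  then have "summable (\<lambda>k. x (Suc k) - x k)"
    by (simp add: x_Suc)
  from summable_LIMSEQ[OF this] have "(\<lambda>n. x n - x 0) \<longlonglongrightarrow> (\<Sum>k. x (Suc k) - x k)"
    by (simp only: sum_lessThan_telescope)
  from tendsto_add[OF this tendsto_const[of "x 0"]] obtain c where c: "x \<longlonglongrightarrow> c"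
    by auto
  \<comment> \<open>The tolerance of \<open>decrease_of_small_step\<close> with
    \<open>norm (v k)\<close> replaced by its lower bound \<open>\<epsilon>\<close>, so that it is
    fixed before \<open>k\<close>.\<close>
  define \<eta> where "\<eta> = (1 - \<rho>) * (l / 2) * \<epsilon>"
  have "\<eta> > 0"
    using assms(12,15,19) by (simp add: \<eta>_def)
  define lin where "lin k j \<longleftrightarrow> norm (f j (x k + (\<alpha> k / \<mu>) *\<^sub>R v k) - f j (x k)
      - transpose (nabla (f j) (x k)) *v ((\<alpha> k / \<mu>) *\<^sub>R v k)) \<le> \<eta> * norm ((\<alpha> k / \<mu>) *\<^sub>R v k)" for k j
  have "\<forall>\<^sub>F k in sequentially. \<forall>j\<in>{1..p}. lin k j"
  proof (rule eventually_ball_finite[OF finite_atLeastAtMost], rule ballI)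
    fix j assume j: "j \<in> {1..p}"
    obtain r where r: "r > 0" "\<And>y d. dist y c < r \<Longrightarrow> norm d < r \<Longrightarrow>
        norm (f j (y + d) - f j y - transpose (nabla (f j) y) *v d) \<le> \<eta> * norm d"
      using C1_uniform_linearization[OF assms(6)[OF j] \<open>\<eta> > 0\<close>] by metis
    \<comment> \<open>The trial step is longer than the accepted one only by the constant factor
      \<open>1 / \<mu>\<close>, so its length also tends to 0.\<close>
    have "(\<lambda>k. (\<alpha> k * norm (v k)) / \<mu>) \<longlonglongrightarrow> 0 / \<mu>"
      using summable_LIMSEQ_zero[OF sum_v] assms(13) by (intro tendsto_divide) auto
    then have "\<forall>\<^sub>F k in sequentially. (\<alpha> k * norm (v k)) / \<mu> < r"
      using r(1) by (intro order_tendstoD) auto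
    with tendstoD[OF c r(1)] show "\<forall>\<^sub>F k in sequentially. lin k j"
    proof eventually_elim
      case (elim k)
      then show ?case
        unfolding lin_def using assms(13) \<alpha>[of k] by (intro r(2)) auto
    qed
  qed
  moreover have "\<forall>\<^sub>F k in sequentially. \<alpha> k < 1"
    using summable_LIMSEQ_zero[OF sum_\<alpha>] by (rule order_tendstoD) simp
  ultimately have "\<forall>\<^sub>F k in sequentially. (\<forall>j\<in>{1..p}. lin k j) \<and> \<alpha> k < 1"
    by (rule eventually_conj)
  then obtain k where k: "\<And>j. j \<in> {1..p} \<Longrightarrow> lin k j" "\<alpha> k < 1"
    using eventually_happens'[OF sequentially_bot] by blast
  obtain i where i: "\<alpha> k = \<mu> ^ i"
      "\<And>i'. i' < i \<Longrightarrow> \<not> sufficient_decrease C p f g \<rho> (x k) (a k) (v k) (\<mu> ^ i')"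
    using ls[of k] by (auto simp: line_search_step_def)
  \<comment> \<open>As \<open>\<alpha> k < 1\<close>, the line search did not stop at the exponent
    0; hence the preceding exponent was tested and rejected.\<close>
  have "i \<noteq> 0"
    using i(1) k(2) by (metis less_irrefl power_0)
  then obtain i' where i': "i = Suc i'"
    using not0_implies_Suc by blast
  have t: "\<alpha> k / \<mu> = \<mu> ^ i'"
    using i(1) i' assms(13) by simp
  have "sufficient_decrease C p f g \<rho> (x k) (a k) (v k) (\<mu> ^ i')"
    unfolding sufficient_decrease_def
  proof
    fix j assume j: "j \<in> {1..omega C p (hfun f g) (x k)}"
    note aj = partition_set_index(1)[OF part j]
    obtain w where w: "hfun f g (a k j) (x k) = Vec w"
      using domH_finite[OF dom aj] by blast
    obtain y where y: "model (f (a k j)) (g (a k j)) (x k) (v k) = Vec y"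
        "\<And>z. z \<in> dual_sphere C \<Longrightarrow> z \<bullet> y \<le> - (l / 2 * (norm (v k))\<^sup>2)"
      using model[OF j] by (auto simp: q_def)
    have "\<eta> \<le> (1 - \<rho>) * (l / 2) * norm (v k)"
      unfolding \<eta>_def using big[of k] assms(12,15) by (intro mult_left_mono) auto
    then show "cone_le C (hfun f g (a k j) (x k + \<mu> ^ i' *\<^sub>R v k))
        (hfun f g (a k j) (x k) + (\<rho> * \<mu> ^ i') *\<^sub>R model (f (a k j)) (g (a k j)) (x k) (v k))"
      using assms(7)[OF aj] w y assms(12,13,14) k(1)[OF aj]
      by (intro decrease_of_small_step[OF C(1,2), where \<eta> = \<eta> and l = l])
        (auto simp: lin_def t power_le_one)
  qed
  then show False
    using i(2)[of i'] i' by blast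
qed

end
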